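(* Let $K,L\subset\mathbb{R}^n$ be convex symmetric bodies, and let $\mu$ be a log-concave probability measure on $\mathbb{R}^n$ with density $e^{-\phi(\|x\|_L)}$ with respect to Lebesgue measure, where $\phi:[0,\infty)\to[0,\infty)$ is an increasing convex function. Let $R>0$ be such that, for all sufficiently large $t$, $$\mu(tRL)\le\mu(tK).$$ Then $RL\subseteq K$.
   Context: A convex body is a convex compact set with nonempty interior; it is symmetric if $K=-K$. The Minkowski functional of $L$ is $\|x\|_L=\min\{\lambda>0:x\in\lambda L\}$ for $x\ne0$, with $\|0\|_L=0$. For $t>0$, $tA=\{ta:a\in A\}$. "Increasing" is understood as non-decreasing (the function $\phi$ may be constant on an initial interval $[0,t_0]$). *)

theory Defs
  imports "HOL-Probability.Probability"
begin

definition convex_body :: "'a::euclidean_space set \<Rightarrow> bool" where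
  "convex_body K \<longleftrightarrow> convex K \<and> compact K \<and> interior K \<noteq> {}"

definition symmetric_set :: "'a::euclidean_space set \<Rightarrow> bool" where
  "symmetric_set K \<longleftrightarrow> uminus ` K = K"

text \<open>For a symmetric convex body the minimum is attained, so \<open>LEAST\<close> on the reals is well defined;
  the origin needs its own clause because the minimum ranges over positive factors only.\<close>

definition minkowski_functional :: "'a::euclidean_space set \<Rightarrow> 'a \<Rightarrow> real" where
  "minkowski_functional L x =
     (if x = 0 then 0 else (LEAST c. c > 0 \<and> x \<in> (*\<^sub>R) c ` L))"

text \<open>Log-concavity in the sense of Borell. Compact sets are used because the Minkowski sum of
  Borel sets need not be Borel.\<close>

definition log_concave_measure :: "'a::euclidean_space measure \<Rightarrow> bool" where
  "log_concave_measure M \<longleftrightarrow> sets M = sets borel \<and>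
     (\<forall>A B. \<forall>l\<in>{0<..<1}. compact A \<longrightarrow> compact B \<longrightarrow>
        measure M {l *\<^sub>R a + (1 - l) *\<^sub>R b | a b. a \<in> A \<and> b \<in> B}
          \<ge> measure M A powr l * measure M B powr (1 - l))"

end

theory Submission
  imports Defs
begin

text \<open>Write \<open>-\<close> for set difference and complement. Suppose \<open>R L\<close> is not contained in \<open>K\<close>. Then for some \<open>l < 1\<close> the set
  \<open>l L - K / R\<close> has positive volume \<open>v\<close>. With \<open>r = t R\<close>, scaling this set by \<open>r\<close> gives
  \<open>\<mu> (- t K) \<ge> exp (- \<phi> (l r)) r^n v\<close>. Conversely, convexity makes \<open>\<phi> - \<phi> 0\<close> superadditive, so
  outside \<open>r L\<close> the density is at most \<open>exp (\<phi> 0 - \<phi> (l r)) exp (- \<phi> (\<parallel>(1 - l) x\<parallel>))\<close>; rescaling and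
  using that \<open>\<mu>\<close> is a probability measure, \<open>\<mu> (- r L) \<le> exp (\<phi> 0 - \<phi> (l r)) / (1 - l)^n\<close>.
  These bounds contradict the hypothesis once \<open>r^n\<close> is large.\<close>

section \<open>Symmetric convex bodies and their Minkowski functional\<close>

lemma zero_in_interior_convex_body:
  fixes L :: "'a::euclidean_space set"
  assumes "convex_body L" "symmetric_set L"
  shows "0 \<in> interior L"
proof -
  obtain a where a: "a \<in> interior L"
    using assms(1) unfolding convex_body_def by auto
  \<comment> \<open>Symmetry passes to the interior, and 0 is the midpoint of a and -a.\<close>
  have "- a \<in> uminus ` interior L"
    using a by blast
  also have "\<dots> = interior L"
    using assms(2) interior_negations[of L] unfolding symmetric_set_def by simp
  finally have "- a \<in> interior L" .
  moreover have "convex (interior L)"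
    using assms(1) unfolding convex_body_def by (simp add: convex_interior)
  ultimately have "(1/2) *\<^sub>R a + (1/2) *\<^sub>R (- a) \<in> interior L"
    using a by (intro convexD) auto
  then show ?thesis by simp
qed

lemma in_scaleR_image_iff:
  fixes x :: "'a::real_vector"
  assumes "c \<noteq> 0"
  shows "x \<in> (*\<^sub>R) c ` L \<longleftrightarrow> inverse c *\<^sub>R x \<in> L"
proof
  assume "inverse c *\<^sub>R x \<in> L"
  then have "c *\<^sub>R inverse c *\<^sub>R x \<in> (*\<^sub>R) c ` L" by blast
  then show "x \<in> (*\<^sub>R) c ` L" using assms by simp
qed (use assms in auto)

text \<open>Boundedness of L keeps the admissible factors away from 0, a ball inside L supplies one
  of them, and closedness of L makes the set of them closed; so its infimum is attained.\<close>

lemma minkowski_functional_attained: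
  fixes L :: "'a::euclidean_space set"
  assumes "compact L" "0 \<in> interior L" "x \<noteq> 0"
  obtains c where "c > 0" "x \<in> (*\<^sub>R) c ` L"
    "\<And>d. d > 0 \<Longrightarrow> x \<in> (*\<^sub>R) d ` L \<Longrightarrow> c \<le> d"
proof -
  obtain B where B: "B > 0" "\<And>y. y \<in> L \<Longrightarrow> norm y \<le> B"
    using compact_imp_bounded[OF assms(1)] unfolding bounded_pos by auto
  obtain e where e: "e > 0" "cball 0 e \<subseteq> L"
    using assms(2) unfolding mem_interior_cball by auto
  \<comment> \<open>Cutting off at \<open>norm x / B\<close> discards no admissible factor, and it
    avoids 0, where \<open>inverse\<close> is discontinuous.\<close>
  define S where "S = {c \<in> {norm x / B..}. inverse c *\<^sub>R x \<in> L}"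
  have pos: "norm x / B > 0" using B assms(3) by simp
  have mem: "c \<in> S" if c: "c > 0" "x \<in> (*\<^sub>R) c ` L" for c
  proof -
    have "inverse c *\<^sub>R x \<in> L" using c in_scaleR_image_iff[of c x L] by simp
    moreover from B(2)[OF this] c B have "norm x / B \<le> c"
      by (simp add: field_simps)
    ultimately show ?thesis unfolding S_def by simp
  qed
  have "closed S"
  proof -
    have "closed ({norm x / B..} \<inter> (\<lambda>c. inverse c *\<^sub>R x) -` L)"
      using pos assms(1)
      by (intro continuous_closed_preimage continuous_intros compact_imp_closed) auto
    also have "{norm x / B..} \<inter> (\<lambda>c. inverse c *\<^sub>R x) -` L = S" unfolding S_def by auto
    finally show ?thesis .
  qed
  moreover have bdd: "bdd_below S" unfolding S_def by (rule bdd_belowI[of _ "norm x / B"]) auto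
  moreover have "norm x / e \<in> S"
  proof (rule mem)
    show "norm x / e > 0" using e assms(3) by simp
    have "inverse (norm x / e) *\<^sub>R x \<in> cball 0 e" using e assms(3) by simp
    then show "x \<in> (*\<^sub>R) (norm x / e) ` L"
      using e assms(3) by (subst in_scaleR_image_iff) auto
  qed
  ultimately have inf: "Inf S \<in> S" using closed_contains_Inf by blast
  then have "Inf S > 0" using pos unfolding S_def by auto
  show thesis
  proof (rule that)
    show "Inf S > 0" by fact
    then show "x \<in> (*\<^sub>R) (Inf S) ` L" using inf by (simp add: S_def in_scaleR_image_iff)
    show "Inf S \<le> d" if "d > 0" "x \<in> (*\<^sub>R) d ` L" for d
      using that by (intro cInf_lower mem bdd)
  qed
qed

text \<open>Attainment turns the \<open>LEAST\<close> of the definition into an actual least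
  element.\<close>

lemma minkowski_functional_Least:
  fixes L :: "'a::euclidean_space set"
  assumes "compact L" "0 \<in> interior L" "x \<noteq> 0"
  shows "minkowski_functional L x > 0" "x \<in> (*\<^sub>R) (minkowski_functional L x) ` L"
    and "\<And>d. d > 0 \<Longrightarrow> x \<in> (*\<^sub>R) d ` L \<Longrightarrow> minkowski_functional L x \<le> d"
proof -
  obtain c where c: "c > 0" "x \<in> (*\<^sub>R) c ` L" "\<And>d. d > 0 \<Longrightarrow> x \<in> (*\<^sub>R) d ` L \<Longrightarrow> c \<le> d"
    using minkowski_functional_attained[OF assms] by blast
  have "minkowski_functional L x = c"
    unfolding minkowski_functional_def using c assms(3) by (auto intro!: Least_equality)
  with c show "minkowski_functional L x > 0" "x \<in> (*\<^sub>R) (minkowski_functional L x) ` L"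
    "\<And>d. d > 0 \<Longrightarrow> x \<in> (*\<^sub>R) d ` L \<Longrightarrow> minkowski_functional L x \<le> d" by auto
qed

lemma minkowski_functional_nonneg:
  fixes L :: "'a::euclidean_space set"
  assumes "compact L" "0 \<in> interior L"
  shows "minkowski_functional L x \<ge> 0"
  using minkowski_functional_Least(1)[OF assms, of x]
  by (cases "x = 0") (auto simp: minkowski_functional_def)

text \<open>Being convex and containing 0, L has nested dilates, so the least factor alone decides
  membership in a dilate.\<close>

lemma minkowski_functional_le_iff:
  fixes L :: "'a::euclidean_space set"
  assumes "convex L" "compact L" "0 \<in> interior L" "c > 0"
  shows "minkowski_functional L x \<le> c \<longleftrightarrow> x \<in> (*\<^sub>R) c ` L"
proof (cases "x = 0")
  case True
  have "0 \<in> L" using assms(3) interior_subset by blast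
  then have "(0::'a) \<in> (*\<^sub>R) c ` L" by (auto intro: image_eqI[where x = 0])
  with True assms(4) show ?thesis by (simp add: minkowski_functional_def)
next
  case False
  note N = minkowski_functional_Least[OF assms(2,3) False]
  show ?thesis
  proof
    assume le: "minkowski_functional L x \<le> c"
    obtain y where y: "y \<in> L" "x = minkowski_functional L x *\<^sub>R y" using N(2) by auto
    have "(minkowski_functional L x / c) *\<^sub>R y + (1 - minkowski_functional L x / c) *\<^sub>R 0 \<in> L"
      using assms y N(1) le interior_subset by (intro convexD) (auto simp: field_simps)
    then have "(minkowski_functional L x / c) *\<^sub>R y \<in> L" by simp
    moreover have "x = c *\<^sub>R ((minkowski_functional L x / c) *\<^sub>R y)" using y assms(4) by simp
    ultimately show "x \<in> (*\<^sub>R) c ` L" by (rule rev_image_eqI)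
  qed (use N(3) assms(4) in blast)
qed

lemma minkowski_functional_scaleR:
  fixes L :: "'a::euclidean_space set"
  assumes "convex L" "compact L" "0 \<in> interior L" "c > 0"
  shows "minkowski_functional L (c *\<^sub>R x) = c * minkowski_functional L x"
proof -
  let ?N = "minkowski_functional L"
  \<comment> \<open>Equality follows by comparing upper bounds. The dilate criterion covers only
    positive d, which suffices because both sides are nonnegative.\<close>
  have iff: "?N (c *\<^sub>R x) \<le> d \<longleftrightarrow> c * ?N x \<le> d" if d: "d > 0" for d
  proof -
    have "?N (c *\<^sub>R x) \<le> d \<longleftrightarrow> ?N x \<le> d / c"
      using d assms(4) by (simp add: minkowski_functional_le_iff[OF assms(1-3)] in_scaleR_image_iff
          inverse_eq_divide)
    also have "\<dots> \<longleftrightarrow> c * ?N x \<le> d" using assms(4) by (simp add: field_simps)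
    finally show ?thesis .
  qed
  have nn: "?N (c *\<^sub>R x) \<ge> 0" "c * ?N x \<ge> 0"
    using minkowski_functional_nonneg[OF assms(2,3)] assms(4) by auto
  show ?thesis
  proof (rule antisym)
    show "?N (c *\<^sub>R x) \<le> c * ?N x"
    proof (rule dense_ge)
      fix d assume "c * ?N x < d"
      with iff[of d] nn show "?N (c *\<^sub>R x) \<le> d" by linarith
    qed
    show "c * ?N x \<le> ?N (c *\<^sub>R x)"
    proof (rule dense_ge)
      fix d assume "?N (c *\<^sub>R x) < d"
      with iff[of d] nn show "c * ?N x \<le> d" by linarith
    qed
  qed
qed

text \<open>Sublevel sets are empty, the single point 0, or compact dilates of L, according to the
  sign of the level.\<close>

lemma borel_measurable_minkowski_functional:
  fixes L :: "'a::euclidean_space set"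
  assumes "convex L" "compact L" "0 \<in> interior L"
  shows "minkowski_functional L \<in> borel_measurable borel"
proof (rule borel_measurableI_le)
  fix c :: real
  note nn = minkowski_functional_nonneg[OF assms(2,3)]
  consider "c < 0" | "c = 0" | "c > 0" by linarith
  then have "{x. minkowski_functional L x \<le> c} \<in> sets borel"
  proof cases
    case 1
    then have "{x. minkowski_functional L x \<le> c} = {}" using nn by (smt (verit) Collect_empty_eq)
    then show ?thesis by simp
  next
    case 2
    then have "{x. minkowski_functional L x \<le> c} = {0}"
      using minkowski_functional_Least(1)[OF assms(2,3)]
      by (force simp: minkowski_functional_def not_le[symmetric])
    then show ?thesis by simp
  next
    case 3
    then have "{x. minkowski_functional L x \<le> c} = (*\<^sub>R) c ` L"
      using minkowski_functional_le_iff[OF assms] by auto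
    then show ?thesis using assms(2) by (simp add: compact_scaling borel_compact)
  qed
  then show "{x \<in> space borel. minkowski_functional L x \<le> c} \<in> sets borel" by simp
qed

section \<open>Lebesgue measure: dilations and open sets\<close>

lemma nn_integral_lborel_scaleR:
  fixes f :: "'a::euclidean_space \<Rightarrow> ennreal"
  assumes "f \<in> borel_measurable borel" "c > 0"
  shows "(\<integral>\<^sup>+x. f x \<partial>lborel) = ennreal (c ^ DIM('a)) * (\<integral>\<^sup>+x. f (c *\<^sub>R x) \<partial>lborel)"
  using assms
  by (subst lborel_affine[of c 0])
     (simp_all add: nn_integral_density nn_integral_distr nn_integral_cmult)

text \<open>The set on the left is the dilate of S by c, written as a preimage so that it is Borel
  at once.\<close>

lemma emeasure_lborel_scaleR:
  fixes S :: "'a::euclidean_space set"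
  assumes "S \<in> sets borel" "c > 0"
  shows "emeasure lborel {x. inverse c *\<^sub>R x \<in> S} = ennreal (c ^ DIM('a)) * emeasure lborel S"
proof -
  have meas: "{x. inverse c *\<^sub>R x \<in> S} \<in> sets borel"
    using measurable_sets[of "\<lambda>x. inverse c *\<^sub>R x" borel borel S] assms(1) by (simp add: vimage_def)
  have "emeasure lborel {x. inverse c *\<^sub>R x \<in> S} = (\<integral>\<^sup>+x. indicator {x. inverse c *\<^sub>R x \<in> S} x \<partial>lborel)"
    using meas by simp
  also have "\<dots> = ennreal (c ^ DIM('a)) *
      (\<integral>\<^sup>+x. indicator {x. inverse c *\<^sub>R x \<in> S} (c *\<^sub>R x) \<partial>lborel)"
    using meas assms(2) by (intro nn_integral_lborel_scaleR) auto
  also have "(\<lambda>x. indicator {x. inverse c *\<^sub>R x \<in> S} (c *\<^sub>R x) :: ennreal) = indicator S"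
    using assms(2) by (auto simp: indicator_def)
  finally show ?thesis using assms(1) by simp
qed

lemma emeasure_lborel_open_pos:
  fixes U :: "'a::euclidean_space set"
  assumes "open U" "U \<noteq> {}"
  shows "emeasure lborel U > 0"
proof -
  have "U \<notin> null_sets lborel"
    using open_not_negligible[OF assms] by (auto simp: negligible_iff_null_sets null_sets_completionI)
  then show ?thesis using assms(1) by (auto simp: null_sets_def zero_less_iff_neq_zero)
qed

section \<open>Superadditivity from convexity, and an open set witnessing non-inclusion\<close>

lemma convex_on_add_le_zero:
  fixes f :: "real \<Rightarrow> real"
  assumes "convex_on {0..} f" "0 \<le> x" "0 \<le> y"
  shows "f x + f y \<le> f (x + y) + f 0"
proof (cases "x + y = 0")
  case False
  with assms have s: "x + y > 0" by linarith
  \<comment> \<open>x and y are the points of weights a and b on the segment from 0 to x + y. The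
    weights sum to 1, so adding the two convexity inequalities leaves one copy each of
    \<open>f 0\<close> and \<open>f (x + y)\<close>.\<close>
  define a b where "a = x / (x + y)" and "b = y / (x + y)"
  have ab: "0 \<le> a" "a \<le> 1" "0 \<le> b" "b \<le> 1" "a + b = 1" "a * (x + y) = x" "b * (x + y) = y"
    using assms s by (auto simp: a_def b_def add_divide_distrib[symmetric])
  have "f (c * (x + y)) \<le> (1 - c) * f 0 + c * f (x + y)" if "0 \<le> c" "c \<le> 1" for c
    using convex_onD[OF assms(1), of c 0 "x + y"] that s by simp
  from this[of a] this[of b] ab(1-4,6,7)
  have "f x + f y \<le> (2 - (a + b)) * f 0 + (a + b) * f (x + y)"
    by (simp add: algebra_simps)
  then show ?thesis using ab by simp
next
  case True
  then have "x = 0" "y = 0" using assms by linarith+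
  then show ?thesis by simp
qed

text \<open>As the complement of K is open, a point of R L outside K survives two perturbations:
  moving it into the interior and shrinking it by some l < 1. The first yields an open set, the
  second the slack 1 - l needed by the tail estimate.\<close>

lemma exists_open_dilate_diff_closed:
  fixes L K :: "'a::euclidean_space set"
  assumes "convex L" "interior L \<noteq> {}" "closed K" "R > 0" "\<not> (*\<^sub>R) R ` L \<subseteq> K"
  obtains l U where "0 < l" "l < (1::real)" "open U" "U \<noteq> {}"
    "U \<subseteq> {z. z \<in> (*\<^sub>R) l ` L \<and> R *\<^sub>R z \<notin> K}"
proof -
  have opn: "open {z. R *\<^sub>R z \<notin> K}"
  proof -
    have "open ((\<lambda>z. R *\<^sub>R z) -` (- K))"
      using assms(3) by (intro open_vimage continuous_intros open_Compl)
    then show ?thesis by (simp add: vimage_def)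
  qed
  obtain x where x: "x \<in> L" "R *\<^sub>R x \<notin> K" using assms(5) by auto
  \<comment> \<open>A convex set with nonempty interior lies in the closure of that interior, so an
    open set meeting L also meets \<open>interior L\<close>.\<close>
  have "x \<in> closure (interior L)"
    using x convex_closure_interior[OF assms(1,2)] closure_subset by blast
  then obtain z where z: "z \<in> interior L" "R *\<^sub>R z \<notin> K"
    using open_Int_closure_eq_empty[OF opn, of "interior L"] x(2) by blast
  have "((\<lambda>c. c *\<^sub>R z) \<longlongrightarrow> 1 *\<^sub>R z) (at_left (1::real))" by (intro tendsto_intros)
  then have "\<forall>\<^sub>F c in at_left (1::real). c *\<^sub>R z \<in> {z. R *\<^sub>R z \<notin> K}"
    by (rule topological_tendstoD) (use opn z in auto)
  moreover have "\<forall>\<^sub>F c in at_left (1::real). c \<in> {0<..<1}"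
    by (rule eventually_at_left_real) simp
  ultimately have "\<forall>\<^sub>F c in at_left (1::real). c \<in> {0<..<1} \<and> R *\<^sub>R c *\<^sub>R z \<notin> K"
    by eventually_elim auto
  then obtain l where l: "0 < l" "l < 1" "R *\<^sub>R l *\<^sub>R z \<notin> K"
    using eventually_happens[of _ "at_left (1::real)"] by (auto simp: trivial_limit_at_left_real)
  show thesis
  proof (rule that[of l "(*\<^sub>R) l ` interior L \<inter> {z. R *\<^sub>R z \<notin> K}"])
    show "open ((*\<^sub>R) l ` interior L \<inter> {z. R *\<^sub>R z \<notin> K})"
      using opn l by (intro open_Int open_scaling) auto
    show "(*\<^sub>R) l ` interior L \<inter> {z. R *\<^sub>R z \<notin> K} \<noteq> {}" using z l by auto
    show "(*\<^sub>R) l ` interior L \<inter> {z. R *\<^sub>R z \<notin> K} \<subseteq> {z. z \<in> (*\<^sub>R) l ` L \<and> R *\<^sub>R z \<notin> K}"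
      using interior_subset[of L] by auto
  qed (use l in auto)
qed

section \<open>Two tail estimates for \<mu> and their comparison\<close>

theorem theorem2:
  fixes K L :: "(real ^ 'n) set"
    and \<mu> :: "(real ^ 'n) measure"
    and \<phi> :: "real \<Rightarrow> real"
    and R :: real
  assumes "convex_body K" and "symmetric_set K"
    and "convex_body L" and "symmetric_set L"
    and "\<And>s. s \<ge> 0 \<Longrightarrow> \<phi> s \<ge> 0"
    and "mono_on {0..} \<phi>"
    and "convex_on {0..} \<phi>"
    and "\<mu> = density lborel (\<lambda>x. ennreal (exp (- \<phi> (minkowski_functional L x))))"
    and "prob_space \<mu>"
    and "log_concave_measure \<mu>"
    and "R > 0"
    and "\<forall>\<^sub>F t in at_top. measure \<mu> ((*\<^sub>R) (t * R) ` L) \<le> measure \<mu> ((*\<^sub>R) t ` K)"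
  shows "(*\<^sub>R) R ` L \<subseteq> K"
proof (rule ccontr)
  assume nsub: "\<not> (*\<^sub>R) R ` L \<subseteq> K"
  interpret prob_space \<mu> by fact
  let ?N = "minkowski_functional L"
  let ?n = "DIM(real ^ 'n)"
  have L: "convex L" "compact L" "0 \<in> interior L"
    using assms(3,4) zero_in_interior_convex_body unfolding convex_body_def by auto
  have cK: "compact K" using assms(1) unfolding convex_body_def by simp
  note le_iff = minkowski_functional_le_iff[OF L]
  note nn = minkowski_functional_nonneg[OF L(2,3)]
  note [measurable] = borel_measurable_minkowski_functional[OF L]
  define f where "f = (\<lambda>x. ennreal (exp (- \<phi> (?N x))))"
  \<comment> \<open>\<phi> is controlled only on the nonnegative reals; extending it by a constant
    gives a monotone, hence Borel, function on the whole line.\<close>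
  have "mono (\<lambda>s. \<phi> (max 0 s))"
    using assms(6) by (auto intro!: monoI simp: mono_on_def)
  then have [measurable]: "(\<lambda>s. \<phi> (max 0 s)) \<in> borel_measurable borel"
    by (rule borel_measurable_mono)
  have "f = (\<lambda>x. ennreal (exp (- \<phi> (max 0 (?N x)))))"
    unfolding f_def using nn by (simp add: max_absorb2)
  then have f_meas [measurable]: "f \<in> borel_measurable borel" by simp
  have \<mu>: "\<mu> = density lborel f" using assms(8) unfolding f_def .
  have sets_\<mu>: "sets \<mu> = sets borel" and space_\<mu>: "space \<mu> = UNIV" unfolding \<mu> by auto
  have scaled_K: "(*\<^sub>R) t ` K \<in> sets borel" and scaled_L: "(*\<^sub>R) t ` L \<in> sets borel" for t
    using cK L(2) by (auto intro!: borel_compact compact_scaling)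

  obtain l U where l: "0 < l" "l < (1::real)" and U: "open U" "U \<noteq> {}"
    and US: "U \<subseteq> {z. z \<in> (*\<^sub>R) l ` L \<and> R *\<^sub>R z \<notin> K}"
    using exists_open_dilate_diff_closed[of L K R] L cK nsub assms(11) compact_imp_closed by blast
  have Upos: "emeasure lborel U > 0" using U by (rule emeasure_lborel_open_pos)
  have "bounded U"
    using US L(2) by (intro bounded_subset[of "(*\<^sub>R) l ` L" U] compact_imp_bounded compact_scaling) auto
  then have Ufin: "emeasure lborel U < \<infinity>" by (rule emeasure_bounded_finite)
  define v where "v = measure lborel U"
  have v: "emeasure lborel U = ennreal v"
    using Ufin unfolding v_def by (simp add: emeasure_eq_ennreal_measure)
  have vpos: "v > 0" using Upos unfolding v by simp

  have lower: "exp (- \<phi> (l * r)) * (r ^ ?n * v) \<le> measure \<mu> (- (*\<^sub>R) (r / R) ` K)"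
    if r: "r > 0" for r
  proof -
    \<comment> \<open>The test set is the dilate r U: it sits inside l r L, which bounds the density
      from below, and outside (r / R) K.\<close>
    let ?V = "{x. inverse r *\<^sub>R x \<in> U}"
    have V_meas [measurable]: "?V \<in> sets borel"
      using measurable_sets[of "\<lambda>x. inverse r *\<^sub>R x" borel borel U] U(1) by (simp add: vimage_def)
    have V_le: "?N x \<le> l * r" if "x \<in> ?V" for x
    proof -
      have "inverse r *\<^sub>R x \<in> (*\<^sub>R) l ` L" using that US by auto
      then have "x \<in> (*\<^sub>R) (l * r) ` L" using r l by (simp add: in_scaleR_image_iff)
      then show ?thesis using le_iff[of "l * r" x] r l by simp
    qed
    have V_sub: "?V \<subseteq> - (*\<^sub>R) (r / R) ` K"
      using US r assms(11) by (auto simp: in_scaleR_image_iff field_simps)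
    have "ennreal (exp (- \<phi> (l * r)) * (r ^ ?n * v)) = ennreal (exp (- \<phi> (l * r))) * emeasure lborel ?V"
      using emeasure_lborel_scaleR[of U r] U(1) r v vpos by (simp add: ennreal_mult)
    also have "\<dots> = (\<integral>\<^sup>+x. ennreal (exp (- \<phi> (l * r))) * indicator ?V x \<partial>lborel)"
      by (simp add: nn_integral_cmult_indicator)
    also have "\<dots> \<le> (\<integral>\<^sup>+x. f x * indicator ?V x \<partial>lborel)"
    proof (intro nn_integral_mono)
      fix x :: "real ^ 'n"
      show "ennreal (exp (- \<phi> (l * r))) * indicator ?V x \<le> f x * indicator ?V x"
        using V_le[of x] mono_onD[OF assms(6), of "?N x" "l * r"] nn[of x] l r
        by (auto simp: f_def indicator_def intro!: ennreal_leI)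
    qed
    also have "\<dots> = emeasure \<mu> ?V" unfolding \<mu> by (simp add: emeasure_density)
    also have "\<dots> \<le> emeasure \<mu> (- (*\<^sub>R) (r / R) ` K)"
      using V_sub scaled_K[of "r / R"] by (intro emeasure_mono) (auto simp: sets_\<mu>)
    finally show ?thesis by (simp add: emeasure_eq_measure)
  qed

  \<comment> \<open>The functional is split into the shares l and k: the first yields the decay
    factor, the second leaves the integrable remainder \<open>f (k *\<^sub>R x)\<close>.\<close>
  define k where "k = 1 - l"
  have k: "k > 0" using l unfolding k_def by simp
  have scaled_f: "(\<integral>\<^sup>+x. f (k *\<^sub>R x) \<partial>lborel) = ennreal (1 / k ^ ?n)"
  proof -
    have "(\<integral>\<^sup>+x. f x \<partial>lborel) = 1"
      using emeasure_space_1 unfolding space_\<mu> unfolding \<mu> by (simp add: emeasure_density)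
    then have *: "1 = ennreal (k ^ ?n) * (\<integral>\<^sup>+x. f (k *\<^sub>R x) \<partial>lborel)"
      using nn_integral_lborel_scaleR[OF f_meas k] by simp
    \<comment> \<open>The power of k is cancelled against its reciprocal as a real number, inside
      \<open>ennreal\<close>.\<close>
    have "ennreal (1 / k ^ ?n) = ennreal (1 / k ^ ?n) * (ennreal (k ^ ?n) * (\<integral>\<^sup>+x. f (k *\<^sub>R x) \<partial>lborel))"
      using * by simp
    also have "\<dots> = ennreal (1 / k ^ ?n * k ^ ?n) * (\<integral>\<^sup>+x. f (k *\<^sub>R x) \<partial>lborel)"
      using k by (subst ennreal_mult) (simp_all add: mult.assoc)
    also have "\<dots> = (\<integral>\<^sup>+x. f (k *\<^sub>R x) \<partial>lborel)" using k by simp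
    finally show ?thesis ..
  qed

  have upper: "measure \<mu> (- (*\<^sub>R) r ` L) \<le> exp (- \<phi> (l * r)) * (exp (\<phi> 0) / k ^ ?n)"
    if r: "r > 0" for r
  proof -
    have meas: "- (*\<^sub>R) r ` L \<in> sets borel" using scaled_L[of r] by auto
    have "emeasure \<mu> (- (*\<^sub>R) r ` L) = (\<integral>\<^sup>+x. f x * indicator (- (*\<^sub>R) r ` L) x \<partial>lborel)"
      unfolding \<mu> using meas by (simp add: emeasure_density)
    also have "\<dots> \<le> (\<integral>\<^sup>+x. ennreal (exp (- \<phi> (l * r)) * exp (\<phi> 0)) * f (k *\<^sub>R x) \<partial>lborel)"
    proof (intro nn_integral_mono)
      fix x :: "real ^ 'n"
      show "f x * indicator (- (*\<^sub>R) r ` L) x \<le> ennreal (exp (- \<phi> (l * r)) * exp (\<phi> 0)) * f (k *\<^sub>R x)"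
      proof (cases "x \<in> (*\<^sub>R) r ` L")
        case False
        then have x: "r < ?N x" using le_iff[OF r, of x] by auto
        have p: "0 \<le> l * r" and q: "0 \<le> k * ?N x" using l r k nn[of x] by auto
        \<comment> \<open>Outside r L the functional exceeds r, so replacing its share l by l r only
          lowers the sum of the two shares; monotonicity of \<phi> then applies.\<close>
        have kN: "k * ?N x \<le> ?N x - l * r"
          using x l unfolding k_def by (simp add: algebra_simps)
        have "\<phi> (l * r) + \<phi> (k * ?N x) \<le> \<phi> (l * r + k * ?N x) + \<phi> 0"
          using convex_on_add_le_zero[OF assms(7) p q] .
        also have "\<phi> (l * r + k * ?N x) \<le> \<phi> (?N x)"
          using kN p q nn[of x] by (intro mono_onD[OF assms(6)]) auto
        finally have "- \<phi> (?N x) \<le> - \<phi> (l * r) + \<phi> 0 + - \<phi> (k * ?N x)" by simp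
        then have "exp (- \<phi> (?N x)) \<le> exp (- \<phi> (l * r)) * exp (\<phi> 0) * exp (- \<phi> (k * ?N x))"
          unfolding exp_add[symmetric] by simp
        \<comment> \<open>Homogeneity turns \<open>k * ?N x\<close> into the functional at
          \<open>k *\<^sub>R x\<close>, so the last factor is \<open>f (k *\<^sub>R x)\<close>,
          whose integral is known.\<close>
        then show ?thesis
          using False by (simp add: f_def minkowski_functional_scaleR[OF L k] ennreal_mult[symmetric] ennreal_leI)
      qed simp
    qed
    also have "\<dots> = ennreal (exp (- \<phi> (l * r)) * exp (\<phi> 0)) * ennreal (1 / k ^ ?n)"
      by (subst nn_integral_cmult) (simp_all add: scaled_f)
    also have "\<dots> = ennreal (exp (- \<phi> (l * r)) * (exp (\<phi> 0) / k ^ ?n))"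
      using k by (simp add: ennreal_mult[symmetric])
    finally show ?thesis using k by (simp add: emeasure_eq_measure)
  qed

  let ?C = "exp (\<phi> 0) / k ^ ?n"
  \<comment> \<open>A linear bound suffices: from t = 1 / R on, t R is at least 1 and is dominated
    by its power with exponent \<open>?n\<close>.\<close>
  have "\<forall>\<^sub>F t in at_top. t * R * v \<le> ?C"
    using assms(12) eventually_ge_at_top[of "1 / R"]
  proof eventually_elim
    case (elim t)
    have r: "t * R \<ge> 1" using elim(2) assms(11) by (simp add: field_simps)
    \<comment> \<open>For a probability measure the hypothesis reverses on complements, which are
      what the two estimates measure.\<close>
    have "measure \<mu> (- (*\<^sub>R) t ` K) \<le> measure \<mu> (- (*\<^sub>R) (t * R) ` L)"
      using elim(1) prob_compl[of "(*\<^sub>R) t ` K"] prob_compl[of "(*\<^sub>R) (t * R) ` L"] scaled_K scaled_L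
      by (simp add: sets_\<mu> space_\<mu> Compl_eq_Diff_UNIV)
    moreover have "exp (- \<phi> (l * (t * R))) * ((t * R) ^ ?n * v) \<le> measure \<mu> (- (*\<^sub>R) t ` K)"
      using lower[of "t * R"] r assms(11) by simp
    moreover have "measure \<mu> (- (*\<^sub>R) (t * R) ` L) \<le> exp (- \<phi> (l * (t * R))) * ?C"
      using r by (intro upper) linarith
    ultimately have "exp (- \<phi> (l * (t * R))) * ((t * R) ^ ?n * v) \<le> exp (- \<phi> (l * (t * R))) * ?C"
      by linarith
    \<comment> \<open>Both estimates carry the same decay factor, evaluated at l t R, so it cancels
      however fast \<phi> grows.\<close>
    then have "(t * R) ^ ?n * v \<le> ?C" by (simp del: times_divide_eq_right)
    moreover have "(t * R) ^ 1 \<le> (t * R) ^ ?n"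
      using r DIM_positive[where 'a = "real ^ 'n"] by (intro power_increasing) linarith+
    ultimately show ?case using vpos by (smt (verit) mult_right_mono power_one_right)
  qed
  \<comment> \<open>Beyond this threshold the linear function with slope R v > 0 exceeds the
    constant.\<close>
  moreover have "\<forall>\<^sub>F t in at_top. t > ?C / (R * v)" by (rule eventually_gt_at_top)
  ultimately have "\<forall>\<^sub>F t::real in at_top. False"
  proof eventually_elim
    case (elim t)
    have "?C < t * (R * v)"
      using elim(2) assms(11) vpos by (simp only: pos_divide_less_eq mult_pos_pos)
    with elim(1) show ?case by (simp only: mult.assoc)
  qed
  then show False by simp
qed

end
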